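(* Let $\phi: B_a\to\mathbb{R}^N$ be a homeomorphism from $B_a$ onto $\mathbb{R}^N$ with $\phi(0)=0$ and $\phi=\nabla\Phi$ on $B_a$, where $\Phi:\overline{B}_a\to\mathbb{R}$ is of class $C^1$ on $B_a$, continuous and strictly convex on $\overline{B}_a$, and $\Phi(0)=0$. Let $\gamma:\mathbb{R}^N\times\mathbb{R}^N\to 2^{\mathbb{R}^N\times\mathbb{R}^N}$ be a maximal monotone operator with $(0,0)\in\gamma(0,0)$, and let $f:\mathbb{Z}[1,T]\times(\mathbb{R}^N)^{T+2}\to\mathbb{R}^N$ be continuous. Assume that there is a real matrix $(c_{ij})_{i,j\in\mathbb{Z}[1,T]}$ with $\sum_{i=1}^T c_{ij}<1$ for all $j\in\mathbb{Z}[1,T]$ and a constant $c\in\mathbb{R}$ such that $$\langle f(n,x^0,\dots,x^{T+1})|x^n\rangle\le (c_{nn}-1)|x^n|^2+\sum_{j=1,\,j\neq n}^T c_{nj}|x^j|^2+c$$ for all $n\in\mathbb{Z}[1,T]$ and $(x^0,\dots,x^{T+1})\in(\mathbb{R}^N)^{T+2}$. Then the problem $$\begin{cases}-\Delta[\phi(\Delta u(n-1))]=f(n,u(0),u(1),\dots,u(T+1)) & (n\in\mathbb{Z}[1,T]),\\ (\phi(\Delta u(0)),-\phi(\Delta u(T)))\in\gamma(u(0),u(T+1))\end{cases}$$ has at least one solution.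
   Context: $N\ge 1$ and $T\ge 2$ are fixed integers and $a>0$ is fixed. $\langle\cdot|\cdot\rangle$ and $|\cdot|$ are the Euclidean inner product and norm on $\mathbb{R}^N$, and $\mathbb{R}^N\times\mathbb{R}^N$ carries its usual inner product (monotonicity is understood with respect to it). $B_a=\{x\in\mathbb{R}^N:|x|<a\}$. $\mathbb{Z}[p,q]=\{p,p+1,\dots,q\}$. For $u:\mathbb{Z}[0,T+1]\to\mathbb{R}^N$: $\Delta u(n-1)=u(n)-u(n-1)$, $\Delta[\phi(\Delta u(n-1))]=\phi(\Delta u(n))-\phi(\Delta u(n-1))$, and $\|\Delta u\|_\infty=\max_{n\in\mathbb{Z}[1,T+1]}|\Delta u(n-1)|$. $D(\gamma)=\{z:\gamma(z)\ne\emptyset\}$. A solution of the problem is a function $u:\mathbb{Z}[0,T+1]\to\mathbb{R}^N$ with $\|\Delta u\|_\infty<a$ and $(u(0),u(T+1))\in D(\gamma)$ that satisfies both the equations and the boundary condition. *)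

theory Defs
  imports "HOL-Analysis.Analysis"
begin

definition strictly_convex_on :: "'a::real_vector set \<Rightarrow> ('a \<Rightarrow> real) \<Rightarrow> bool" where
  "strictly_convex_on S g \<longleftrightarrow> convex S \<and>
    (\<forall>x\<in>S. \<forall>y\<in>S. \<forall>t. x \<noteq> y \<and> 0 < t \<and> t < 1 \<longrightarrow>
       g ((1 - t) *\<^sub>R x + t *\<^sub>R y) < (1 - t) * g x + t * g y)"

(* Used for open S only: GDERIV is the derivative with respect to the whole space. *)
definition C1_on :: "'a::real_inner set \<Rightarrow> ('a \<Rightarrow> real) \<Rightarrow> bool" where
  "C1_on S g \<longleftrightarrow> (\<exists>g'. continuous_on S g' \<and> (\<forall>x\<in>S. GDERIV g x :> g' x))"

(* Set-valued operators on a real inner product space H are functions from H to sets in H. *)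
definition op_dom :: "('h \<Rightarrow> 'h set) \<Rightarrow> 'h set" where
  "op_dom A = {z. A z \<noteq> {}}"

definition monotone_op :: "('h::real_inner \<Rightarrow> 'h set) \<Rightarrow> bool" where
  "monotone_op A \<longleftrightarrow>
    (\<forall>z z'. \<forall>w\<in>A z. \<forall>w'\<in>A z'. 0 \<le> inner (w - w') (z - z'))"

definition maximal_monotone_op :: "('h::real_inner \<Rightarrow> 'h set) \<Rightarrow> bool" where
  "maximal_monotone_op A \<longleftrightarrow> monotone_op A \<and>
    (\<forall>B. monotone_op B \<and> (\<forall>z. A z \<subseteq> B z) \<longrightarrow> B = A)"

definition fwd_diff :: "(nat \<Rightarrow> 'a::ab_group_add) \<Rightarrow> nat \<Rightarrow> 'a" where
  "fwd_diff u m = u (Suc m) - u m"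

definition diff_sup_norm :: "nat \<Rightarrow> (nat \<Rightarrow> 'a::real_normed_vector) \<Rightarrow> real" where
  "diff_sup_norm T u = Max ((\<lambda>n. norm (fwd_diff u (n - 1))) ` {1..T + 1})"

(* Functions on Z[0,T+1], and likewise tuples (x^0,...,x^(T+1)), are represented by the
   extensional functions on {0..T+1}.  The equation is only imposed at n \<ge> 1, so n - 1 is not
   truncated. *)
definition is_solution ::
  "nat \<Rightarrow> real \<Rightarrow> ('e::real_inner \<Rightarrow> 'e) \<Rightarrow> ('e \<times> 'e \<Rightarrow> ('e \<times> 'e) set) \<Rightarrow>
   (nat \<Rightarrow> (nat \<Rightarrow> 'e) \<Rightarrow> 'e) \<Rightarrow> (nat \<Rightarrow> 'e) \<Rightarrow> bool" where
  "is_solution T a \<phi> \<gamma> f u \<longleftrightarrow>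
     u \<in> {0..T + 1} \<rightarrow>\<^sub>E UNIV \<and>
     diff_sup_norm T u < a \<and>
     (u 0, u (T + 1)) \<in> op_dom \<gamma> \<and>
     (\<forall>n\<in>{1..T}. - fwd_diff (\<lambda>m. \<phi> (fwd_diff u m)) (n - 1) = f n u) \<and>
     (\<phi> (fwd_diff u 0), - \<phi> (fwd_diff u T)) \<in> \<gamma> (u 0, u (T + 1))"

end

theory Submission
  imports Defs
begin

text \<open>
  Pair the equation with \<open>u\<close> and sum over \<open>n\<close>.  Summation by parts produces the terms
  \<open>inner (\<phi> (\<Delta>u)) (\<Delta>u)\<close>, which are nonnegative since \<open>\<phi>\<close> is monotone with \<open>\<phi> 0 = 0\<close>, and a boundary
  term, which is nonnegative since \<open>\<gamma>\<close> is monotone with \<open>(0, 0) \<in> \<gamma> (0, 0)\<close>.  Because the column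
  sums of \<open>C\<close> are at most \<open>1 - \<epsilon>\<close> for some \<open>\<epsilon> > 0\<close>, the right-hand side is at most
  \<open>T c - \<epsilon> (\<Sum>n=1..T. (norm (u n))\<^sup>2)\<close> (\<open>dissipative_sum\<close>).  Hence \<open>u\<close> is bounded a priori,
  and so are the numbers \<open>inner (\<phi> (\<Delta>u)) (\<Delta>u)\<close>, which by \<open>monotone_sublevel_inside\<close> forces the
  differences of \<open>u\<close> to have norm less than some \<open>\<rho> < a\<close>.

  Existence follows by making every ingredient continuous and globally defined without losing these
  bounds.  The map \<open>\<phi>\<close> is composed with the radial retraction onto the ball of radius \<open>\<rho>\<close>, and \<open>\<gamma>\<close>
  is replaced by its Yosida approximation with parameter \<open>\<mu>\<close> (\<open>yosida_approximation\<close>, which rests on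
  Minty's theorem) plus \<open>\<mu>\<close> times the identity.  The resulting finite system is coercive, so it has
  a zero (\<open>finite_vectors_zero\<close>, a consequence of the Poincare--Miranda theorem); this is
  \<open>regularized_problem\<close>.  The a priori bounds are uniform in \<open>\<mu>\<close> and show that the truncation of \<open>\<phi>\<close>
  is not active.  As \<open>\<mu>\<close> tends to zero, a subsequence of the solutions converges, and the boundary
  condition passes to the limit because the graph of \<open>\<gamma>\<close> is closed (\<open>maximal_monotone_closed\<close>).
\<close>

section \<open>Zeros of continuous maps on finitely many coordinates\<close>

lemma tendsto_fun_iff:
  fixes f :: "'b \<Rightarrow> 'i \<Rightarrow> 'a::topological_space"
  shows "(f \<longlongrightarrow> l) F \<longleftrightarrow> (\<forall>i. ((\<lambda>c. f c i) \<longlongrightarrow> l i) F)"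
  using limitin_componentwise[of "\<lambda>_. euclidean" UNIV f l F]
  by (simp add: euclidean_product_topology)

text \<open>The function space carries the product topology, so this is Tychonoff's theorem.\<close>

lemma compact_norm_bounded_funs:
  "compact {x :: 'i \<Rightarrow> 'a::euclidean_space. \<forall>i. norm (x i) \<le> R}"
proof -
  have "compactin (product_topology (\<lambda>_. euclidean) UNIV) (Pi\<^sub>E UNIV (\<lambda>_::'i. cball (0::'a) R))"
    by (subst compactin_PiE) auto
  moreover have "Pi\<^sub>E UNIV (\<lambda>_. cball 0 R) = {x :: 'i \<Rightarrow> 'a. \<forall>i. norm (x i) \<le> R}"
    by (auto simp: PiE_def Pi_def)
  ultimately show ?thesis
    by (simp add: euclidean_product_topology)
qed

text \<open>
  The Poincare--Miranda theorem for the coordinates in a finite set \<open>I\<close>, each ranging over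
  \<open>[-R, R]\<close>; the remaining coordinates are only required to be bounded by \<open>R\<close>.  The index set is
  not a finite type: the number of unknowns of the boundary value problem depends on the
  number \<open>T\<close>, so no fixed Euclidean space type can hold them.  The proof labels the points of a
  grid with the sign of the component of \<open>g\<close>; Kuhn's combinatorial lemma yields arbitrarily small
  cells in which every component takes both signs, and a limit point of these cells is a zero.
\<close>

lemma poincare_miranda:
  fixes g :: "('i::countable \<Rightarrow> real) \<Rightarrow> 'i \<Rightarrow> real"
  assumes "finite I" and "R > 0"
    and cont: "\<And>i. i \<in> I \<Longrightarrow> continuous_on UNIV (\<lambda>x. g x i)"
    and lower: "\<And>x i. \<lbrakk>i \<in> I; \<forall>j. \<bar>x j\<bar> \<le> R; x i = -R\<rbrakk> \<Longrightarrow> g x i \<le> 0"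
    and upper: "\<And>x i. \<lbrakk>i \<in> I; \<forall>j. \<bar>x j\<bar> \<le> R; x i = R\<rbrakk> \<Longrightarrow> g x i \<ge> 0"
  shows "\<exists>x. (\<forall>j. \<bar>x j\<bar> \<le> R) \<and> (\<forall>i\<in>I. g x i = 0)"
proof -
  obtain b where b: "bij_betw b {..<card I} I"
    using ex_bij_betw_nat_finite[OF \<open>finite I\<close>] by (auto simp: atLeast0LessThan)
  define b' where "b' = inv_into {..<card I} b"
  have b'_lt: "b' i < card I" and b_b': "b (b' i) = i" if "i \<in> I" for i
    using that b unfolding b'_def bij_betw_def
    by (metis inv_into_into lessThan_iff, metis f_inv_into_f)
  have b_in: "b m \<in> I" and b'_b: "b' (b m) = m" if "m < card I" for m
    using that b unfolding b'_def bij_betw_def by auto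
  \<comment> \<open>the point of the cube with grid indices \<open>q\<close>, each edge being divided into \<open>p\<close> parts\<close>
  define X where "X p q i = (if i \<in> I then -R + 2 * R * (real (q (b' i)) / real p) else 0)"
    for p :: nat and q :: "nat \<Rightarrow> nat" and i
  have X_box: "\<bar>X p q i\<bar> \<le> R" if "p > 0" "\<And>m. m < card I \<Longrightarrow> q m \<le> p" for p q i
  proof (cases "i \<in> I")
    case True
    have "real (q (b' i)) / real p \<le> 1" "0 \<le> real (q (b' i)) / real p"
      using that b'_lt[OF True] by auto
    then have "2 * R * (real (q (b' i)) / real p) \<le> 2 * R"
      "0 \<le> 2 * R * (real (q (b' i)) / real p)"
      using \<open>R > 0\<close> by (auto intro: mult_left_le simp del: times_divide_eq_right)
    with True show ?thesis by (simp add: X_def abs_le_iff)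
  qed (use \<open>R > 0\<close> in \<open>simp add: X_def\<close>)
  have grid: "\<exists>q r s. (\<forall>m<card I. q m < p) \<and>
      (\<forall>i\<in>I. (\<forall>m<card I. q m \<le> r i m \<and> r i m \<le> q m + 1) \<and>
             (\<forall>m<card I. q m \<le> s i m \<and> s i m \<le> q m + 1) \<and>
             g (X p (r i)) i \<ge> 0 \<and> g (X p (s i)) i \<le> 0)" if "p > 0" for p :: nat
  proof -
    \<comment> \<open>On the two opposite faces the label is prescribed, and the hypotheses on the faces make it
      agree with the sign of \<open>g\<close>; the face \<open>x m = p\<close> is tested first, which is harmless since
      \<open>p > 0\<close>.\<close>
    define label where "label x m =
      (if x m = p then 1 else if x m = 0 then 0 else if g (X p x) (b m) \<ge> 0 then 1 else 0 :: nat)"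
      for x :: "nat \<Rightarrow> nat" and m
    have lab01: "label x m = 0 \<or> label x m = 1" for x m by (simp add: label_def)
    have lab1: "g (X p x) (b m) \<ge> 0" if "label x m = 1" "m < card I" "\<And>m. m < card I \<Longrightarrow> x m \<le> p" for x m
    proof (cases "x m = p")
      case True
      then show ?thesis
        using that \<open>p > 0\<close> X_box by (intro upper) (auto simp: X_def b_in b'_b)
    qed (use that in \<open>auto simp: label_def split: if_splits\<close>)
    have lab0: "g (X p x) (b m) \<le> 0" if "label x m = 0" "m < card I" "\<And>m. m < card I \<Longrightarrow> x m \<le> p" for x m
    proof (cases "x m = 0")
      case True
      then show ?thesis
        using that \<open>p > 0\<close> X_box by (intro lower) (auto simp: X_def b_in b'_b)
    qed (use that in \<open>auto simp: label_def split: if_splits\<close>)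
    obtain q where q: "\<forall>m<card I. q m < p"
      and rs: "\<forall>m<card I. \<exists>r s. (\<forall>j<card I. q j \<le> r j \<and> r j \<le> q j + 1) \<and>
        (\<forall>j<card I. q j \<le> s j \<and> s j \<le> q j + 1) \<and> label r m \<noteq> label s m"
      by (rule kuhn_lemma[of p "card I" label]) (use \<open>p > 0\<close> in \<open>auto simp: label_def\<close>)
    have "\<exists>r s. (\<forall>m<card I. q m \<le> r m \<and> r m \<le> q m + 1) \<and>
             (\<forall>m<card I. q m \<le> s m \<and> s m \<le> q m + 1) \<and>
             g (X p r) i \<ge> 0 \<and> g (X p s) i \<le> 0" if i: "i \<in> I" for i
    proof -
      obtain r s where r: "\<forall>j<card I. q j \<le> r j \<and> r j \<le> q j + 1"
        and s: "\<forall>j<card I. q j \<le> s j \<and> s j \<le> q j + 1" and ne: "label r (b' i) \<noteq> label s (b' i)"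
        using rs b'_lt[OF i] by blast
      have le: "r m \<le> p" "s m \<le> p" if "m < card I" for m
        using that q r s by (metis Suc_eq_plus1 Suc_leI le_trans)+
      have "label r (b' i) = 1 \<and> label s (b' i) = 0 \<or> label r (b' i) = 0 \<and> label s (b' i) = 1"
        using ne lab01[of r "b' i"] lab01[of s "b' i"] by linarith
      then show ?thesis
      proof
        assume "label r (b' i) = 1 \<and> label s (b' i) = 0"
        then show ?thesis
          using lab1[of r "b' i"] lab0[of s "b' i"] le b'_lt[OF i] b_b'[OF i] r s by auto
      next
        assume "label r (b' i) = 0 \<and> label s (b' i) = 1"
        then show ?thesis
          using lab1[of s "b' i"] lab0[of r "b' i"] le b'_lt[OF i] b_b'[OF i] r s by auto
      qed
    qed
    then show ?thesis using q by metis
  qed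
  define P where "P k q r s \<longleftrightarrow> (\<forall>m<card I. q m < Suc k) \<and>
      (\<forall>i\<in>I. (\<forall>m<card I. q m \<le> r i m \<and> r i m \<le> q m + 1) \<and>
             (\<forall>m<card I. q m \<le> s i m \<and> s i m \<le> q m + 1) \<and>
             g (X (Suc k) (r i)) i \<ge> 0 \<and> g (X (Suc k) (s i)) i \<le> 0)"
    for k :: nat and q :: "nat \<Rightarrow> nat" and r s
  have "\<forall>k. \<exists>q r s. P k q r s"
    unfolding P_def using grid[OF zero_less_Suc] by blast
  then obtain q r s where P: "\<And>k. P k (q k) (r k) (s k)" by metis
  have q: "q k m < Suc k" if "m < card I" for k m using P[of k] that by (auto simp: P_def)
  have r: "q k m \<le> r k i m \<and> r k i m \<le> q k m + 1" if "i \<in> I" "m < card I" for k i m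
    using P[of k] that by (auto simp: P_def)
  have s: "q k m \<le> s k i m \<and> s k i m \<le> q k m + 1" if "i \<in> I" "m < card I" for k i m
    using P[of k] that by (auto simp: P_def)
  have gr: "g (X (Suc k) (r k i)) i \<ge> 0" and gs: "g (X (Suc k) (s k i)) i \<le> 0" if "i \<in> I" for k i
    using P[of k] that by (auto simp: P_def)
  define y where "y k = X (Suc k) (q k)" for k
  have "y k \<in> {x. \<forall>i. \<bar>x i\<bar> \<le> R}" for k
    using X_box[of "Suc k" "q k"] q[of _ k] by (auto simp: y_def less_imp_le)
  moreover have "seq_compact {x :: 'i \<Rightarrow> real. \<forall>i. \<bar>x i\<bar> \<le> R}"
    using compact_imp_seq_compact[OF compact_norm_bounded_funs[where 'a = real, of R]] by simp
  ultimately obtain l \<sigma> where l: "l \<in> {x. \<forall>i. \<bar>x i\<bar> \<le> R}" and \<sigma>: "strict_mono \<sigma>" and lim: "(y \<circ> \<sigma>) \<longlonglongrightarrow> l"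
    using seq_compactE[of _ y] by blast
  have near: "(\<lambda>k. X (Suc (\<sigma> k)) (t (\<sigma> k))) \<longlonglongrightarrow> l"
    if t: "\<And>k m. m < card I \<Longrightarrow> q k m \<le> t k m \<and> t k m \<le> q k m + 1" for t
  proof -
    have "(\<lambda>k. X (Suc (\<sigma> k)) (t (\<sigma> k)) j) \<longlonglongrightarrow> l j" for j
    proof -
      have "\<bar>X (Suc k) (t k) j - y k j\<bar> \<le> 2 * R * (1 / real (Suc k))" for k
      proof (cases "j \<in> I")
        case True
        then have "X (Suc k) (t k) j - y k j = 2 * R * ((real (t k (b' j)) - real (q k (b' j))) / real (Suc k))"
          by (simp add: X_def y_def diff_divide_distrib right_diff_distrib del: of_nat_Suc)
        moreover have "0 \<le> (real (t k (b' j)) - real (q k (b' j)))" "(real (t k (b' j)) - real (q k (b' j))) \<le> 1"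
          using t[OF b'_lt[OF True], of k] by auto
        ultimately show ?thesis
          using \<open>R > 0\<close> by (simp add: abs_mult divide_right_mono del: of_nat_Suc)
      qed (use \<open>R > 0\<close> in \<open>simp add: X_def y_def\<close>)
      then have "\<forall>\<^sub>F k in sequentially.
          norm (X (Suc k) (t k) j - y k j) \<le> 2 * R * (1 / real (Suc k))"
        by (simp del: of_nat_Suc)
      moreover have "(\<lambda>k. 2 * R * (1 / real (Suc k))) \<longlonglongrightarrow> 0"
        by (rule tendsto_mult_right_zero[OF LIMSEQ_inverse_real_of_nat[unfolded inverse_eq_divide]])
      ultimately have "(\<lambda>k. X (Suc k) (t k) j - y k j) \<longlonglongrightarrow> 0"
        by (rule Lim_null_comparison)
      then have "((\<lambda>k. X (Suc k) (t k) j - y k j) \<circ> \<sigma>) \<longlonglongrightarrow> 0"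
        using \<sigma> by (rule LIMSEQ_subseq_LIMSEQ)
      moreover have "(\<lambda>k. y (\<sigma> k) j) \<longlonglongrightarrow> l j"
        using lim by (simp add: tendsto_fun_iff)
      ultimately show ?thesis
        using tendsto_add[of _ 0 sequentially "\<lambda>k. y (\<sigma> k) j" "l j"] by (fastforce simp: o_def)
    qed
    then show ?thesis by (simp add: tendsto_fun_iff)
  qed
  have "g l i = 0" if i: "i \<in> I" for i
  proof -
    have tend: "(\<lambda>k. g (X (Suc (\<sigma> k)) (t (\<sigma> k))) i) \<longlonglongrightarrow> g l i"
      if t: "\<And>k m. m < card I \<Longrightarrow> q k m \<le> t k m \<and> t k m \<le> q k m + 1" for t
      using continuous_on_tendsto_compose[OF cont[OF i] near[OF t]] by simp
    have "g l i \<ge> 0"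
      using tend[of "\<lambda>k. r k i"] r[OF i] gr[OF i] by (intro LIMSEQ_le_const) auto
    moreover have "g l i \<le> 0"
      using tend[of "\<lambda>k. s k i"] s[OF i] gs[OF i] by (intro LIMSEQ_le_const2) auto
    ultimately show ?thesis by simp
  qed
  then show ?thesis using l by blast
qed

text \<open>
  The acute angle criterion: a continuous map that never points strictly inwards on a sphere has a
  zero.  Apply \<open>poincare_miranda\<close> to \<open>x - r (x - G x)\<close> with \<open>r\<close> the radial retraction onto the
  Euclidean ball of radius \<open>R\<close>: at a fixed point \<open>x\<close> of \<open>r (x - G x)\<close>, either \<open>G x = 0\<close>, or \<open>x\<close> is on
  the sphere and \<open>G x\<close> is a negative multiple of \<open>x\<close>.  Coordinates outside \<open>I\<close> play no role.
\<close>

lemma finite_coords_zero: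
  fixes G :: "('i::countable \<Rightarrow> real) \<Rightarrow> 'i \<Rightarrow> real"
  assumes "finite I" and "R > 0"
    and cont: "\<And>i. i \<in> I \<Longrightarrow> continuous_on UNIV (\<lambda>x. G x i)"
    and outward: "\<And>x. (\<Sum>i\<in>I. (x i)\<^sup>2) = R\<^sup>2 \<Longrightarrow> 0 \<le> (\<Sum>i\<in>I. G x i * x i)"
  shows "\<exists>x. \<forall>i\<in>I. G x i = 0"
proof -
  define N where "N x = L2_set (\<lambda>i. x i - G x i) I" for x
  define g where "g x i = x i - R / max R (N x) * (x i - G x i)" for x i
  have contN: "continuous_on UNIV N"
    unfolding N_def L2_set_def by (intro continuous_intros cont continuous_on_product_coordinates)
  have "\<exists>x. (\<forall>j. \<bar>x j\<bar> \<le> R) \<and> (\<forall>i\<in>I. g x i = 0)"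
  proof (rule poincare_miranda[OF \<open>finite I\<close> \<open>R > 0\<close>])
    show "continuous_on UNIV (\<lambda>x. g x i)" if "i \<in> I" for i
      unfolding g_def using that \<open>R > 0\<close>
      by (intro continuous_intros cont contN continuous_on_product_coordinates) (auto simp: max_def)
    have bd: "\<bar>R / max R (N x) * (x i - G x i)\<bar> \<le> R" if "i \<in> I" for x i
    proof -
      have "\<bar>x i - G x i\<bar> \<le> N x"
        unfolding N_def using member_le_L2_set[OF \<open>finite I\<close> that, of "\<lambda>i. \<bar>x i - G x i\<bar>"]
        by (simp add: L2_set_def)
      then have "R * \<bar>x i - G x i\<bar> \<le> R * max R (N x)"
        using \<open>R > 0\<close> by (intro mult_left_mono) auto
      then show ?thesis
        using \<open>R > 0\<close> by (simp add: abs_mult pos_divide_le_eq less_max_iff_disj)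
    qed
    show "g x i \<le> 0" if "i \<in> I" "x i = - R" for x i
      using bd[OF that(1), of x] that(2) unfolding g_def abs_le_iff by linarith
    show "0 \<le> g x i" if "i \<in> I" "x i = R" for x i
      using bd[OF that(1), of x] that(2) unfolding g_def abs_le_iff by linarith
  qed
  then obtain x where x: "\<And>i. i \<in> I \<Longrightarrow> g x i = 0" by blast
  show ?thesis
  proof (cases "N x \<le> R")
    case True
    then show ?thesis
      using x \<open>R > 0\<close> by (intro exI[of _ x]) (auto simp: g_def max_def)
  next
    case False
    define \<mu> where "\<mu> = N x / R"
    have "\<mu> > 1" using False \<open>R > 0\<close> by (simp add: \<mu>_def)
    have eq: "x i - G x i = \<mu> * x i" if "i \<in> I" for i
      using x[OF that] False \<open>R > 0\<close> by (auto simp: g_def \<mu>_def field_simps max_def split: if_splits)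
    have "N x = L2_set (\<lambda>i. \<mu> * x i) I"
      unfolding N_def by (intro L2_set_cong) (auto simp: eq)
    also have "\<dots> = \<mu> * L2_set x I"
      using \<open>\<mu> > 1\<close> by (simp add: L2_set_right_distrib)
    finally have "L2_set x I = R"
      using \<open>R > 0\<close> False by (simp add: \<mu>_def nonzero_eq_divide_eq)
    then have sq: "(\<Sum>i\<in>I. (x i)\<^sup>2) = R\<^sup>2"
      unfolding L2_set_def using real_sqrt_pow2[of "\<Sum>i\<in>I. (x i)\<^sup>2"] by (simp add: sum_nonneg)
    have "(\<Sum>i\<in>I. G x i * x i) = (\<Sum>i\<in>I. (1 - \<mu>) * (x i)\<^sup>2)"
    proof (intro sum.cong refl)
      fix i assume "i \<in> I"
      then have "G x i = (1 - \<mu>) * x i" using eq[of i] by (simp add: left_diff_distrib)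
      then show "G x i * x i = (1 - \<mu>) * (x i)\<^sup>2" by (simp add: power2_eq_square)
    qed
    also have "\<dots> = (1 - \<mu>) * R\<^sup>2"
      by (simp add: sq flip: sum_distrib_left)
    also have "\<dots> < 0"
      using \<open>\<mu> > 1\<close> \<open>R > 0\<close> by (intro mult_neg_pos) auto
    finally show ?thesis using outward[OF sq] by simp
  qed
qed

lemma finite_vectors_zero:
  fixes G :: "(nat \<Rightarrow> real ^ 'n) \<Rightarrow> nat \<Rightarrow> real ^ 'n"
  assumes "finite I" and "R > 0"
    and cont: "\<And>n. n \<in> I \<Longrightarrow> continuous_on UNIV (\<lambda>u. G u n)"
    and outward: "\<And>u. (\<Sum>n\<in>I. (norm (u n))\<^sup>2) = R\<^sup>2 \<Longrightarrow> 0 \<le> (\<Sum>n\<in>I. inner (G u n) (u n))"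
  shows "\<exists>u. \<forall>n\<in>I. G u n = 0"
proof -
  define V :: "(nat \<times> 'n \<Rightarrow> real) \<Rightarrow> nat \<Rightarrow> real ^ 'n" where "V x n = (\<chi> i. x (n, i))" for x n
  have "\<exists>x. \<forall>p \<in> I \<times> UNIV. G (V x) (fst p) $ snd p = 0"
  proof (rule finite_coords_zero)
    have "continuous_on UNIV V"
      unfolding V_def by (intro continuous_on_coordinatewise_then_product continuous_on_vec_lambda continuous_on_product_coordinates)
    then show "continuous_on UNIV (\<lambda>x. G (V x) (fst p) $ snd p)" if "p \<in> I \<times> UNIV" for p
      using that by (intro continuous_on_component continuous_on_compose2[OF cont]) auto
    show "0 \<le> (\<Sum>p\<in>I \<times> UNIV. G (V x) (fst p) $ snd p * x p)"
      if "(\<Sum>p\<in>I \<times> UNIV. (x p)\<^sup>2) = R\<^sup>2" for x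
    proof -
      have "(\<Sum>n\<in>I. (norm (V x n))\<^sup>2) = (\<Sum>p\<in>I \<times> UNIV. (x p)\<^sup>2)"
        unfolding power2_norm_eq_inner inner_vec_def
        by (simp add: V_def sum.cartesian_product split_beta power2_eq_square)
      moreover have "(\<Sum>n\<in>I. inner (G (V x) n) (V x n)) = (\<Sum>p\<in>I \<times> UNIV. G (V x) (fst p) $ snd p * x p)"
        by (simp add: V_def inner_vec_def sum.cartesian_product split_beta)
      ultimately show ?thesis using outward[of "V x"] that by simp
    qed
  qed (use assms in auto)
  then obtain x where "\<forall>p \<in> I \<times> UNIV. G (V x) (fst p) $ snd p = 0" ..
  then show ?thesis by (intro exI[of _ "V x"]) (auto simp: vec_eq_iff)
qed

section \<open>Maximal monotone operators\<close>

lemma monotone_opD: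
  "monotone_op A \<Longrightarrow> w \<in> A z \<Longrightarrow> w' \<in> A z' \<Longrightarrow> 0 \<le> inner (w - w') (z - z')"
  by (auto simp: monotone_op_def)

text \<open>
  The Debrunner--Flor extension property for finite monotone sets.  If no \<open>x\<close> works, the negative
  parts of the inner products, normalized to have sum one, are the weights of a continuous convex
  combination of the points \<open>z\<close>, and Brouwer's theorem gives a point \<open>x\<close> that is its own
  combination.  The weighted sum of the inner products at \<open>x\<close> is then negative, whereas after
  symmetrization monotonicity shows that it is nonnegative.
\<close>

lemma debrunner_flor_finite:
  fixes g :: "'a::euclidean_space \<Rightarrow> 'a" and G :: "('a \<times> 'a) set"
  assumes "finite G" and "G \<noteq> {}"
    and mono: "\<And>z w z' w'. (z, w) \<in> G \<Longrightarrow> (z', w') \<in> G \<Longrightarrow> 0 \<le> inner (w - w') (z - z')"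
    and cont: "continuous_on UNIV g"
  shows "\<exists>x. \<forall>(z, w)\<in>G. 0 \<le> inner (w - g x) (z - x)"
proof (rule ccontr)
  assume "\<not> ?thesis"
  then have neg: "\<exists>p\<in>G. inner (snd p - g x) (fst p - x) < 0" for x
    by (force simp: not_le)
  define \<beta> where "\<beta> p x = max 0 (- inner (snd p - g x) (fst p - x))" for p x
  define S where "S x = (\<Sum>p\<in>G. \<beta> p x)" for x
  have \<beta>0: "\<beta> p x \<ge> 0" for p x by (simp add: \<beta>_def)
  have Spos: "S x > 0" for x
  proof -
    obtain p where "p \<in> G" "inner (snd p - g x) (fst p - x) < 0" using neg by blast
    then have "\<beta> p x > 0" by (simp add: \<beta>_def)
    then show ?thesis
      unfolding S_def using \<open>p \<in> G\<close> \<open>finite G\<close> \<beta>0 by (intro sum_pos2[where i = p]) auto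
  qed
  define h where "h x = (\<Sum>p\<in>G. (\<beta> p x / S x) *\<^sub>R fst p)" for x
  have cont\<beta>: "continuous_on UNIV (\<beta> p)" for p
    unfolding \<beta>_def by (intro continuous_intros cont)
  have conth: "continuous_on UNIV h"
    unfolding h_def S_def using Spos
    by (intro continuous_intros cont\<beta>) (auto simp: S_def less_imp_neq[symmetric])
  have "h x \<in> convex hull (fst ` G)" for x
    unfolding h_def
  proof (rule convex_sum)
    show "(\<Sum>p\<in>G. \<beta> p x / S x) = 1"
      using Spos[of x] by (simp add: S_def flip: sum_divide_distrib)
  qed (use \<open>finite G\<close> \<beta>0 less_imp_le[OF Spos] in \<open>auto intro: hull_inc divide_nonneg_nonneg\<close>)
  then obtain x where x: "h x = x"
    using brouwer[of "convex hull (fst ` G)" h] \<open>finite G\<close> \<open>G \<noteq> {}\<close>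
      continuous_on_subset[OF conth, of "convex hull (fst ` G)"]
    by (auto simp: finite_imp_compact_convex_hull)
  define b where "b p = \<beta> p x / S x" for p
  have b0: "b p \<ge> 0" for p using \<beta>0 Spos[of x] by (simp add: b_def)
  have bsum: "(\<Sum>p\<in>G. b p) = 1"
    using Spos[of x] by (simp add: b_def S_def flip: sum_divide_distrib)
  have bx: "(\<Sum>p\<in>G. b p *\<^sub>R fst p) = x"
    using x by (simp add: h_def b_def)
  have zero: "(\<Sum>p\<in>G. b p *\<^sub>R (fst p - x)) = 0"
    by (simp add: scaleR_diff_right sum_subtractf bx bsum flip: scaleR_left.sum)
  have inner_x: "inner v (fst p - x) = (\<Sum>q\<in>G. b q * inner v (fst p - fst q))" for v p
  proof -
    have "fst p - x = (\<Sum>q\<in>G. b q *\<^sub>R (fst p - fst q))"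
      by (simp add: scaleR_diff_right sum_subtractf bx bsum flip: scaleR_left.sum)
    then show ?thesis by (simp add: inner_sum_right)
  qed
  have "(\<Sum>p\<in>G. b p * inner (snd p - g x) (fst p - x)) < 0"
  proof -
    obtain p where p: "p \<in> G" "inner (snd p - g x) (fst p - x) < 0" using neg by blast
    then have "b p > 0" using Spos[of x] by (simp add: b_def \<beta>_def divide_neg_pos)
    then have *: "b p * inner (snd p - g x) (fst p - x) < 0" using p by (simp add: mult_pos_neg)
    have "b q * inner (snd q - g x) (fst q - x) \<le> 0" for q
    proof (cases "inner (snd q - g x) (fst q - x) \<le> 0")
      case False
      then show ?thesis by (simp add: b_def \<beta>_def)
    qed (simp add: mult_nonneg_nonpos b0)
    then have "(\<Sum>p\<in>G. b p * inner (snd p - g x) (fst p - x)) < (\<Sum>p\<in>G. 0)"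
      using * p \<open>finite G\<close> by (intro sum_strict_mono_ex1) auto
    then show ?thesis by simp
  qed
  moreover have "(\<Sum>p\<in>G. b p * inner (snd p - g x) (fst p - x))
      = (\<Sum>p\<in>G. b p * inner (snd p) (fst p - x)) - inner (g x) (\<Sum>p\<in>G. b p *\<^sub>R (fst p - x))"
    by (simp add: inner_diff_left inner_sum_right right_diff_distrib sum_subtractf)
  moreover have "0 \<le> (\<Sum>p\<in>G. b p * inner (snd p) (fst p - x))"
  proof -
    define D where "D = (\<Sum>p\<in>G. \<Sum>q\<in>G. b p * (b q * inner (snd p) (fst p - fst q)))"
    have D: "(\<Sum>p\<in>G. b p * inner (snd p) (fst p - x)) = D"
      by (simp add: inner_x sum_distrib_left D_def)
    have D': "D = (\<Sum>p\<in>G. \<Sum>q\<in>G. b q * (b p * inner (snd q) (fst q - fst p)))"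
      unfolding D_def by (rule sum.swap)
    have "2 * D = (\<Sum>p\<in>G. \<Sum>q\<in>G. b p * b q * inner (snd p - snd q) (fst p - fst q))"
      unfolding mult_2 by (subst D', subst D_def)
        (simp add: inner_diff_left inner_diff_right algebra_simps flip: sum.distrib)
    also have "\<dots> \<ge> 0"
      using mono b0 by (intro sum_nonneg mult_nonneg_nonneg) auto
    finally show ?thesis using D by simp
  qed
  ultimately show False using zero by simp
qed

text \<open>A pair that is monotonically related to a maximal monotone graph belongs to the graph.\<close>

lemma maximal_monotone_memI:
  assumes max: "maximal_monotone_op A"
    and rel: "\<And>z' w'. w' \<in> A z' \<Longrightarrow> 0 \<le> inner (w - w') (z - z')"
  shows "w \<in> A z"
proof -
  define B where "B = A(z := insert w (A z))"
  have mono: "0 \<le> inner (w - w') (z - z')" if "w \<in> A z" "w' \<in> A z'" for w w' z z'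
    using max that unfolding maximal_monotone_op_def monotone_op_def by blast
  have rel': "0 \<le> inner (w' - w) (z' - z)" if "w' \<in> A z'" for w' z'
    using rel[OF that] by (metis inner_minus_left inner_minus_right minus_diff_eq)
  have "monotone_op B"
    unfolding monotone_op_def B_def using mono rel rel' by (auto split: if_splits)
  moreover have "\<forall>y. A y \<subseteq> B y" by (auto simp: B_def)
  ultimately have "B = A" using max unfolding maximal_monotone_op_def by blast
  moreover have "w \<in> B z" by (simp add: B_def)
  ultimately show ?thesis by simp
qed

text \<open>The graph of a maximal monotone operator is closed.\<close>

lemma maximal_monotone_closed:
  assumes max: "maximal_monotone_op A"
    and "\<And>k. w k \<in> A (z k)" and "z \<longlonglongrightarrow> z0" and "w \<longlonglongrightarrow> w0"
  shows "w0 \<in> A z0"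
proof (rule maximal_monotone_memI[OF max])
  fix z' w' assume "w' \<in> A z'"
  then have "0 \<le> inner (w k - w') (z k - z')" for k
    using max assms(2) monotone_opD unfolding maximal_monotone_op_def by blast
  moreover have "(\<lambda>k. inner (w k - w') (z k - z')) \<longlonglongrightarrow> inner (w0 - w') (z0 - z')"
    by (intro tendsto_intros assms)
  ultimately show "0 \<le> inner (w0 - w') (z0 - z')"
    by (intro LIMSEQ_le_const) auto
qed

text \<open>
  Minty's theorem: \<open>I + \<mu> A\<close> is onto.  The conditions imposed on \<open>z\<close> by finitely many points of the
  graph can be satisfied by the Debrunner--Flor property; including \<open>(z0, w0)\<close> among them confines
  \<open>z\<close> to a fixed ball, so compactness satisfies all of them at once, and maximality concludes.
\<close>

lemma minty_surjective:
  fixes A :: "'a::euclidean_space \<Rightarrow> 'a set"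
  assumes max: "maximal_monotone_op A" and w0: "w0 \<in> A z0" and "\<mu> > 0"
  shows "\<exists>z. (y - z) /\<^sub>R \<mu> \<in> A z"
proof -
  have mono: "monotone_op A" using max by (simp add: maximal_monotone_op_def)
  define Gr where "Gr = {(z, w). w \<in> A z}"
  define g where "g x = (y - x) /\<^sub>R \<mu>" for x
  have contg: "continuous_on UNIV g" unfolding g_def by (intro continuous_intros)
  define F where "F p = {x. 0 \<le> inner (snd p - g x) (fst p - x)}" for p
  define K where "K = cball z0 (norm (y - z0 - \<mu> *\<^sub>R w0))"
  have "K \<inter> (\<Inter>p\<in>Gr. F p) \<noteq> {}"
  proof (rule compact_imp_fip_image)
    show "compact K" by (simp add: K_def)
    show "closed (F p)" for p
      unfolding F_def by (intro closed_Collect_le continuous_intros contg)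
    show "K \<inter> (\<Inter>p\<in>G. F p) \<noteq> {}" if G: "finite G" "G \<subseteq> Gr" for G
    proof -
      have "\<exists>x. \<forall>(z, w)\<in>insert (z0, w0) G. 0 \<le> inner (w - g x) (z - x)"
        using G w0 by (intro debrunner_flor_finite contg monotone_opD[OF mono]) (auto simp: Gr_def)
      then obtain x where x: "0 \<le> inner (w0 - g x) (z0 - x)" "\<And>p. p \<in> G \<Longrightarrow> x \<in> F p"
        by (fastforce simp: F_def split_beta)
      have "0 \<le> \<mu> * inner (w0 - g x) (z0 - x)" using x \<open>\<mu> > 0\<close> by simp
      also have "\<dots> = inner (\<mu> *\<^sub>R w0 - (y - x)) (z0 - x)"
        using \<open>\<mu> > 0\<close> by (simp add: g_def flip: inner_scaleR_left) (simp add: scaleR_diff_right)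
      also have "\<dots> = inner (y - z0 - \<mu> *\<^sub>R w0) (x - z0) - (norm (x - z0))\<^sup>2"
        by (simp add: power2_norm_eq_inner inner_diff_left inner_diff_right inner_commute algebra_simps)
      finally have "norm (x - z0) * norm (x - z0) \<le> norm (y - z0 - \<mu> *\<^sub>R w0) * norm (x - z0)"
        using norm_cauchy_schwarz[of "y - z0 - \<mu> *\<^sub>R w0" "x - z0"] by (simp add: power2_eq_square)
      then have "norm (x - z0) \<le> norm (y - z0 - \<mu> *\<^sub>R w0)"
        by (cases "norm (x - z0) = 0") (auto simp: mult_le_cancel_right)
      then have "x \<in> K" by (simp add: K_def dist_norm norm_minus_commute)
      then show ?thesis using x(2) by blast
    qed
  qed
  then obtain x where x: "\<And>z w. w \<in> A z \<Longrightarrow> 0 \<le> inner (w - g x) (z - x)"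
    unfolding F_def Gr_def by force
  have "g x \<in> A x"
  proof (rule maximal_monotone_memI[OF max])
    show "0 \<le> inner (g x - w) (x - z)" if "w \<in> A z" for z w
      using x[OF that] by (metis inner_minus_left inner_minus_right minus_diff_eq)
  qed
  then show ?thesis unfolding g_def by blast
qed

text \<open>
  The Yosida approximation \<open>Y\<close> of \<open>A\<close>, namely \<open>(I - J) / \<mu>\<close> with \<open>J\<close> the resolvent of \<open>\<mu> A\<close>; it is
  continuous because \<open>J\<close> is nonexpansive.
\<close>

lemma yosida_approximation:
  fixes A :: "'a::euclidean_space \<Rightarrow> 'a set"
  assumes max: "maximal_monotone_op A" and "w0 \<in> A z0" and "\<mu> > 0"
  obtains Y where "continuous_on UNIV Y" and "\<And>y. Y y \<in> A (y - \<mu> *\<^sub>R Y y)"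
proof -
  obtain J where J: "\<And>y. (y - J y) /\<^sub>R \<mu> \<in> A (J y)"
    using minty_surjective[OF assms] by metis
  have "dist (J y) (J y') \<le> 1 * dist y y'" for y y'
  proof -
    have "0 \<le> \<mu> * inner ((y - J y) /\<^sub>R \<mu> - (y' - J y') /\<^sub>R \<mu>) (J y - J y')"
      using max J \<open>\<mu> > 0\<close> monotone_opD unfolding maximal_monotone_op_def
      by (metis mult_nonneg_nonneg less_imp_le)
    also have "\<dots> = inner (y - y' - (J y - J y')) (J y - J y')"
      using \<open>\<mu> > 0\<close> by (simp flip: inner_scaleR_left) (simp add: scaleR_diff_right algebra_simps)
    finally have "norm (J y - J y') * norm (J y - J y') \<le> norm (y - y') * norm (J y - J y')"
      using norm_cauchy_schwarz[of "y - y'" "J y - J y'"]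
      by (simp add: inner_diff_left[of "y - y'"] power2_norm_eq_inner flip: power2_eq_square)
    then show ?thesis
      by (cases "norm (J y - J y') = 0") (auto simp: dist_norm mult_le_cancel_right)
  qed
  then have contJ: "continuous_on UNIV J"
    by (intro lipschitz_on_continuous_on[of 1] lipschitz_onI) auto
  show thesis
  proof
    show "continuous_on UNIV (\<lambda>y. (y - J y) /\<^sub>R \<mu>)"
      by (intro continuous_intros contJ)
    show "(y - J y) /\<^sub>R \<mu> \<in> A (y - \<mu> *\<^sub>R ((y - J y) /\<^sub>R \<mu>))" for y
      using J[of y] \<open>\<mu> > 0\<close> by simp
  qed
qed

section \<open>Gradients of convex functions on a ball\<close>

lemma strictly_convex_on_imp_convex_on: "strictly_convex_on S g \<Longrightarrow> convex_on S g"
proof (rule convex_onI)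
  fix t :: real and x y assume *: "strictly_convex_on S g" "0 < t" "t < 1" "x \<in> S" "y \<in> S"
  show "g ((1 - t) *\<^sub>R x + t *\<^sub>R y) \<le> (1 - t) * g x + t * g y"
  proof (cases "x = y")
    case True
    then show ?thesis by (simp add: algebra_simps flip: scaleR_left.add)
  next
    case False
    with * show ?thesis by (simp add: strictly_convex_on_def less_imp_le)
  qed
qed (simp add: strictly_convex_on_def)

lemma convex_on_gradient_inequality:
  fixes g :: "'a::real_inner \<Rightarrow> real"
  assumes conv: "convex_on S g" and x: "x \<in> S" and y: "y \<in> S" and d: "GDERIV g x :> d"
  shows "g x + inner d (y - x) \<le> g y"
proof -
  define h where "h t = g (x + t *\<^sub>R (y - x))" for t :: real
  have "(h has_derivative (\<lambda>t. inner (t *\<^sub>R (y - x)) d)) (at 0)"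
    unfolding h_def
    by (rule has_derivative_compose[where g = g and g' = "\<lambda>v. inner v d"])
      (auto intro!: derivative_eq_intros d[unfolded gderiv_def] simp: d[unfolded gderiv_def])
  then have "(h has_real_derivative inner d (y - x)) (at 0)"
    unfolding has_field_derivative_def by (rule has_derivative_eq_rhs) (auto simp: inner_commute)
  then have "((\<lambda>t. (h t - h 0) / t) \<longlongrightarrow> inner d (y - x)) (at 0)"
    by (simp add: has_field_derivative_iff)
  then have "((\<lambda>t. (h t - h 0) / t) \<longlongrightarrow> inner d (y - x)) (at_right 0)"
    by (rule filterlim_mono) (auto intro: at_le)
  moreover have "\<forall>\<^sub>F t in at_right 0. (h t - h 0) / t \<le> g y - g x"
  proof (rule eventually_at_rightI[of 0 1])
    fix t :: real assume t: "t \<in> {0<..<1}"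
    have "g ((1 - t) *\<^sub>R x + t *\<^sub>R y) \<le> (1 - t) * g x + t * g y"
      using t by (intro convex_onD[OF conv _ _ x y]) auto
    moreover have "(1 - t) *\<^sub>R x + t *\<^sub>R y = x + t *\<^sub>R (y - x)"
      by (simp add: algebra_simps)
    ultimately show "(h t - h 0) / t \<le> g y - g x"
      using t by (simp add: h_def field_simps)
  qed simp
  ultimately have "inner d (y - x) \<le> g y - g x"
    by (rule tendsto_upperbound) simp
  then show ?thesis by simp
qed

lemma convex_gradient_monotone:
  assumes conv: "convex_on S g" and "x \<in> S" "y \<in> S" and "GDERIV g x :> d" "GDERIV g y :> e"
  shows "0 \<le> inner (d - e) (x - y)"
  using convex_on_gradient_inequality[OF conv assms(2,3,4)]
    convex_on_gradient_inequality[OF conv assms(3,2,5)]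
  by (simp add: inner_diff_left inner_diff_right)

text \<open>
  A bound on \<open>inner (\<phi> v) v\<close> keeps \<open>v\<close> away from the boundary of the ball.  By monotonicity against
  the point \<open>w\<close> of norm \<open>a / 2\<close> in the direction of \<open>\<phi> v\<close> (zero if \<open>\<phi> v = 0\<close>), the bound controls the norm of \<open>\<phi> v\<close>, so
  that \<open>v\<close> lies in the image under the continuous inverse \<open>\<psi>\<close> of a closed ball, a compact subset of
  the open ball.
\<close>

lemma monotone_sublevel_inside:
  fixes \<phi> :: "'a::euclidean_space \<Rightarrow> 'a"
  assumes "a > 0" and hom: "homeomorphism (ball 0 a) UNIV \<phi> \<psi>"
    and mono: "\<And>x y. x \<in> ball 0 a \<Longrightarrow> y \<in> ball 0 a \<Longrightarrow> 0 \<le> inner (\<phi> x - \<phi> y) (x - y)"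
  obtains \<rho> where "0 < \<rho>" "\<rho> < a" "\<And>v. v \<in> ball 0 a \<Longrightarrow> inner (\<phi> v) v \<le> B \<Longrightarrow> norm v < \<rho>"
proof -
  define r where "r = a / 2"
  have r: "0 < r" "r < a" using \<open>a > 0\<close> by (auto simp: r_def)
  have cont: "continuous_on (ball 0 a) \<phi>" and continv: "continuous_on UNIV \<psi>"
    and inv: "\<And>v. v \<in> ball 0 a \<Longrightarrow> \<psi> (\<phi> v) = v" and im: "\<psi> ` UNIV = ball 0 a"
    using hom by (auto simp: homeomorphism_def)
  have "compact (\<phi> ` cball 0 r)"
    using r by (intro compact_continuous_image continuous_on_subset[OF cont]) auto
  then obtain M where M: "\<And>w. norm w \<le> r \<Longrightarrow> norm (\<phi> w) \<le> M" and "M > 0"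
    by (metis bounded_pos compact_imp_bounded imageI mem_cball_0)
  have est: "r * norm (\<phi> v) \<le> B + M * (2 * a)" if v: "v \<in> ball 0 a" and B: "inner (\<phi> v) v \<le> B" for v
  proof -
    define w where "w = r *\<^sub>R sgn (\<phi> v)"
    have w: "norm w \<le> r" using r by (simp add: w_def norm_sgn)
    have "inner (\<phi> v) (sgn (\<phi> v)) = norm (\<phi> v)"
      by (simp add: sgn_div_norm dot_square_norm power2_eq_square field_simps)
    then have "r * norm (\<phi> v) = inner (\<phi> v) w" by (simp add: w_def)
    also have "\<dots> \<le> inner (\<phi> v) v + inner (\<phi> w) (w - v)"
      using mono[OF v, of w] w r by (simp add: inner_diff_left inner_diff_right)
    also have "inner (\<phi> w) (w - v) \<le> norm (\<phi> w) * norm (w - v)"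
      by (rule norm_cauchy_schwarz)
    also have "\<dots> \<le> M * (2 * a)"
      using M[OF w] w r v norm_triangle_ineq4[of w v] \<open>M > 0\<close> by (intro mult_mono) auto
    finally show ?thesis using B by simp
  qed
  define L where "L = max 0 ((B + M * (2 * a)) / r)"
  have "compact (\<psi> ` cball 0 L)"
    by (intro compact_continuous_image continuous_on_subset[OF continv]) auto
  moreover have "\<psi> ` cball 0 L \<noteq> {}" by (auto simp: L_def)
  ultimately obtain x where x: "x \<in> \<psi> ` cball 0 L" "\<And>y. y \<in> \<psi> ` cball 0 L \<Longrightarrow> norm y \<le> norm x"
    using continuous_attains_sup[of "\<psi> ` cball 0 L" norm] continuous_on_norm_id by blast
  have "norm x < a" using x(1) im by auto
  show thesis
  proof
    show "0 < (norm x + a) / 2" "(norm x + a) / 2 < a"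
      using \<open>norm x < a\<close> \<open>a > 0\<close> by (auto simp: add_nonneg_pos)
    show "norm v < (norm x + a) / 2" if "v \<in> ball 0 a" "inner (\<phi> v) v \<le> B" for v
    proof -
      have "norm (\<phi> v) \<le> L"
        using est[OF that] r by (simp add: L_def le_max_iff_disj field_simps)
      then have "v \<in> \<psi> ` cball 0 L"
        using inv[OF that(1)] by (metis image_eqI mem_cball_0)
      then have "norm v \<le> norm x" by (rule x(2))
      then show ?thesis using \<open>norm x < a\<close> by simp
    qed
  qed
qed

section \<open>The regularized boundary value problem\<close>

text \<open>The radial retraction of the whole space onto the closed ball of radius \<open>\<rho> > 0\<close>.\<close>

definition radial_retraction :: "real \<Rightarrow> 'a::real_normed_vector \<Rightarrow> 'a" where
  "radial_retraction \<rho> x = (\<rho> / max \<rho> (norm x)) *\<^sub>R x"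

lemma continuous_on_radial_retraction: "\<rho> > 0 \<Longrightarrow> continuous_on S (radial_retraction \<rho>)"
  unfolding radial_retraction_def by (intro continuous_intros) (auto simp: max_def)

lemma norm_radial_retraction: "\<rho> > 0 \<Longrightarrow> norm (radial_retraction \<rho> x) = min \<rho> (norm x)"
  by (auto simp: radial_retraction_def max_def min_def)

lemma radial_retraction_id: "\<rho> > 0 \<Longrightarrow> norm (radial_retraction \<rho> x) < \<rho> \<Longrightarrow> radial_retraction \<rho> x = x"
  by (auto simp: radial_retraction_def max_def split: if_splits)

lemma fwd_diff_comp:
  "fwd_diff (\<lambda>m. p (fwd_diff u m)) n = p (fwd_diff u (Suc n)) - p (fwd_diff u n)"
  by (simp add: fwd_diff_def)

lemma summation_by_parts:
  fixes q u :: "nat \<Rightarrow> 'a::real_inner"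
  shows "(\<Sum>n=1..T. inner (fwd_diff q (n - 1)) (u n)) =
    inner (q T) (u (T + 1)) - inner (q 0) (u 0) - (\<Sum>n\<le>T. inner (q n) (fwd_diff u n))"
  by (induction T) (auto simp: fwd_diff_def inner_diff_left inner_diff_right)

text \<open>
  The problem with everywhere defined continuous maps \<open>p\<close> and \<open>Y\<close> in place of \<open>\<phi>\<close> and \<open>\<gamma>\<close>, and with
  the term \<open>\<mu> (u 0, u (T + 1))\<close> added to the boundary condition.  This term makes the system coercive
  in all \<open>T + 2\<close> unknowns, since \<open>F\<close> is dissipative only in \<open>u 1, ..., u T\<close>.  The last two
  conclusions are bounds that do not depend on \<open>\<mu>\<close>, \<open>p\<close> and \<open>Y\<close>.
\<close>

lemma regularized_problem:
  fixes p :: "real ^ 'n \<Rightarrow> real ^ 'n" and Y :: "(real ^ 'n) \<times> (real ^ 'n) \<Rightarrow> (real ^ 'n) \<times> (real ^ 'n)"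
    and F :: "nat \<Rightarrow> (nat \<Rightarrow> real ^ 'n) \<Rightarrow> real ^ 'n"
  assumes "\<epsilon> > 0" and "\<mu> > 0"
    and contp: "continuous_on UNIV p" and p: "\<And>x. 0 \<le> inner (p x) x"
    and contY: "continuous_on UNIV Y" and Y: "\<And>z. 0 \<le> inner (Y z) z"
    and contF: "\<And>n. n \<in> {1..T} \<Longrightarrow> continuous_on UNIV (F n)"
    and F: "\<And>u. (\<Sum>n=1..T. inner (F n u) (u n)) \<le> K - \<epsilon> * (\<Sum>n=1..T. (norm (u n))\<^sup>2)"
  obtains u where
    "\<And>n. n \<in> {1..T} \<Longrightarrow> - fwd_diff (\<lambda>m. p (fwd_diff u m)) (n - 1) = F n u"
    "(p (fwd_diff u 0), - p (fwd_diff u T)) = Y (u 0, u (T + 1)) + \<mu> *\<^sub>R (u 0, u (T + 1))"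
    "\<And>n. n \<le> T \<Longrightarrow> inner (p (fwd_diff u n)) (fwd_diff u n) \<le> K"
    "\<And>n. n \<in> {1..T} \<Longrightarrow> \<epsilon> * (norm (u n))\<^sup>2 \<le> K"
proof -
  define z where "z u = (u 0, u (T + 1))" for u :: "nat \<Rightarrow> real ^ 'n"
  define W where "W u = Y (z u) + \<mu> *\<^sub>R z u" for u
  define q where "q u = (\<lambda>m. p (fwd_diff u m))" for u
  \<comment> \<open>The zeros of \<open>G\<close> are the solutions; its signs are such that, after summation by parts,
    pairing \<open>G u\<close> with \<open>u\<close> produces only nonnegative terms besides that of \<open>F\<close>.\<close>
  define G where "G u n =
    (if n = 0 then fst (W u) - q u 0
     else if n = T + 1 then snd (W u) + q u T
     else - fwd_diff (q u) (n - 1) - F n u)" for u n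
  define E where "E u = (\<Sum>n\<le>T. inner (q u n) (fwd_diff u n))" for u
  have E: "0 \<le> E u" for u by (auto simp: E_def q_def intro!: sum_nonneg p)
  have energy: "(\<Sum>n\<in>{0..T + 1}. inner (G u n) (u n)) =
      E u + inner (Y (z u)) (z u) + \<mu> * (norm (z u))\<^sup>2 - (\<Sum>n=1..T. inner (F n u) (u n))" for u
  proof -
    have "{0..T + 1} = insert 0 (insert (T + 1) {1..T})" by auto
    then have "(\<Sum>n\<in>{0..T + 1}. inner (G u n) (u n)) =
        inner (G u 0) (u 0) + inner (G u (T + 1)) (u (T + 1)) + (\<Sum>n=1..T. inner (G u n) (u n))"
      by simp
    also have "(\<Sum>n=1..T. inner (G u n) (u n)) =
        (\<Sum>n=1..T. - inner (fwd_diff (q u) (n - 1)) (u n) - inner (F n u) (u n))"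
      by (intro sum.cong) (auto simp: G_def inner_diff_left)
    also have "\<dots> = - (\<Sum>n=1..T. inner (fwd_diff (q u) (n - 1)) (u n)) - (\<Sum>n=1..T. inner (F n u) (u n))"
      by (simp add: sum_subtractf sum_negf)
    also have "inner (G u 0) (u 0) + inner (G u (T + 1)) (u (T + 1)) =
        inner (W u) (z u) - inner (q u 0) (u 0) + inner (q u T) (u (T + 1))"
      by (simp add: G_def z_def inner_prod_def inner_diff_left inner_add_left)
    also have "inner (W u) (z u) = inner (Y (z u)) (z u) + \<mu> * (norm (z u))\<^sup>2"
      by (simp add: W_def inner_add_left power2_norm_eq_inner)
    finally show ?thesis
      unfolding summation_by_parts E_def by simp
  qed
  have normz: "(norm (z u))\<^sup>2 = (norm (u 0))\<^sup>2 + (norm (u (T + 1)))\<^sup>2" for u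
    by (simp add: z_def norm_Pair)
  define R where "R = sqrt ((\<bar>K\<bar> + 1) / min \<epsilon> \<mu>)"
  have R: "R > 0" "min \<epsilon> \<mu> * R\<^sup>2 \<ge> K"
    using \<open>\<epsilon> > 0\<close> \<open>\<mu> > 0\<close> by (auto simp: R_def)
  have "\<exists>u. \<forall>n\<in>{0..T + 1}. G u n = 0"
  proof (rule finite_vectors_zero[OF _ \<open>R > 0\<close>])
    have cz: "continuous_on UNIV z"
      unfolding z_def by (intro continuous_intros continuous_on_product_coordinates)
    have cW: "continuous_on UNIV W"
      unfolding W_def by (intro continuous_intros cz continuous_on_compose2[OF contY cz]) auto
    have cq: "continuous_on UNIV (\<lambda>u. q u m)" for m
      unfolding q_def fwd_diff_def
      by (rule continuous_on_compose2[OF contp])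
        (auto intro!: continuous_intros continuous_on_product_coordinates)
    show "continuous_on UNIV (\<lambda>u. G u n)" if "n \<in> {0..T + 1}" for n
    proof -
      consider "n = 0" | "n = T + 1" | "n \<in> {1..T}" "n \<noteq> 0" "n \<noteq> T + 1" using \<open>n \<in> {0..T + 1}\<close> by force
      then show ?thesis
      proof cases
        case 3
        then show ?thesis
          unfolding G_def fwd_diff_def by (auto intro!: continuous_intros cq contF)
      qed (auto simp: G_def intro!: continuous_intros cW cq)
    qed
    show "0 \<le> (\<Sum>n\<in>{0..T + 1}. inner (G u n) (u n))"
      if u: "(\<Sum>n\<in>{0..T + 1}. (norm (u n))\<^sup>2) = R\<^sup>2" for u
    proof -
      have "{0..T + 1} = insert 0 (insert (T + 1) {1..T})" by auto
      then have "R\<^sup>2 = (norm (z u))\<^sup>2 + (\<Sum>n=1..T. (norm (u n))\<^sup>2)"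
        using u by (simp add: normz)
      then have "K \<le> min \<epsilon> \<mu> * (norm (z u))\<^sup>2 + min \<epsilon> \<mu> * (\<Sum>n=1..T. (norm (u n))\<^sup>2)"
        using R(2) by (simp add: distrib_left)
      also have "\<dots> \<le> \<mu> * (norm (z u))\<^sup>2 + \<epsilon> * (\<Sum>n=1..T. (norm (u n))\<^sup>2)"
        by (intro add_mono mult_right_mono sum_nonneg) auto
      finally show ?thesis
        using F[of u] E[of u] Y[of "z u"] energy[of u] by linarith
    qed
  qed simp
  then obtain u where u: "\<And>n. n \<in> {0..T + 1} \<Longrightarrow> G u n = 0" by blast
  have "(\<Sum>n\<in>{0..T + 1}. inner (G u n) (u n)) = 0"
    by (intro sum.neutral) (simp add: u)
  then have bound: "E u + \<epsilon> * (\<Sum>n=1..T. (norm (u n))\<^sup>2) \<le> K"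
    using F[of u] Y[of "z u"] energy[of u] mult_nonneg_nonneg[OF less_imp_le[OF \<open>\<mu> > 0\<close>] zero_le_power2[of "norm (z u)"]]
    by linarith
  show thesis
  proof
    show "- fwd_diff (\<lambda>m. p (fwd_diff u m)) (n - 1) = F n u" if "n \<in> {1..T}" for n
      using u[of n] that by (auto simp: G_def q_def)
    show "(p (fwd_diff u 0), - p (fwd_diff u T)) = Y (u 0, u (T + 1)) + \<mu> *\<^sub>R (u 0, u (T + 1))"
      using u[of 0] u[of "T + 1"]
      by (simp add: G_def W_def z_def q_def prod_eq_iff neg_eq_iff_add_eq_0 add.commute)
    show "inner (p (fwd_diff u n)) (fwd_diff u n) \<le> K" if "n \<le> T" for n
    proof -
      have "inner (p (fwd_diff u n)) (fwd_diff u n) \<le> E u"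
        unfolding E_def q_def using that by (intro member_le_sum) (auto simp: p)
      moreover have "0 \<le> \<epsilon> * (\<Sum>n=1..T. (norm (u n))\<^sup>2)"
        using \<open>\<epsilon> > 0\<close> by (simp add: sum_nonneg)
      ultimately show ?thesis using bound by simp
    qed
    show "\<epsilon> * (norm (u n))\<^sup>2 \<le> K" if "n \<in> {1..T}" for n
    proof -
      have "(norm (u n))\<^sup>2 \<le> (\<Sum>n=1..T. (norm (u n))\<^sup>2)"
        using that by (intro member_le_sum) auto
      then have "\<epsilon> * (norm (u n))\<^sup>2 \<le> \<epsilon> * (\<Sum>n=1..T. (norm (u n))\<^sup>2)"
        using \<open>\<epsilon> > 0\<close> by (intro mult_left_mono) auto
      then show ?thesis using bound E[of u] by simp
    qed
  qed
qed

section \<open>Existence of a solution\<close>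

text \<open>
  Summed over \<open>n\<close>, the growth condition with \<open>b n\<close> the squared norm of \<open>x n\<close> involves the matrix only
  through its column sums.
\<close>

lemma dissipative_sum:
  fixes b :: "nat \<Rightarrow> real" and C :: "nat \<Rightarrow> nat \<Rightarrow> real"
  assumes col: "\<And>j. j \<in> {1..T} \<Longrightarrow> (\<Sum>i=1..T. C i j) \<le> 1 - \<epsilon>" and b: "\<And>j. 0 \<le> b j"
  shows "(\<Sum>n=1..T. (C n n - 1) * b n + (\<Sum>j\<in>{1..T} - {n}. C n j * b j) + c)
    \<le> real T * c - \<epsilon> * (\<Sum>n=1..T. b n)"
proof -
  have "(C n n - 1) * b n + (\<Sum>j\<in>{1..T} - {n}. C n j * b j) + c = (\<Sum>j=1..T. C n j * b j) - b n + c"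
    if "n \<in> {1..T}" for n
    using sum.remove[of "{1..T}" n "\<lambda>j. C n j * b j"] that by (simp add: left_diff_distrib)
  then have "(\<Sum>n=1..T. (C n n - 1) * b n + (\<Sum>j\<in>{1..T} - {n}. C n j * b j) + c) =
      (\<Sum>n=1..T. \<Sum>j=1..T. C n j * b j) - (\<Sum>n=1..T. b n) + real T * c"
    by (simp add: sum.distrib sum_subtractf)
  also have "(\<Sum>n=1..T. \<Sum>j=1..T. C n j * b j) = (\<Sum>j=1..T. (\<Sum>n=1..T. C n j) * b j)"
    by (subst sum.swap) (simp add: sum_distrib_right)
  also have "\<dots> \<le> (\<Sum>j=1..T. (1 - \<epsilon>) * b j)"
    using col b by (intro sum_mono mult_right_mono) auto
  finally show ?thesis
    by (simp add: left_diff_distrib sum_subtractf sum_distrib_left)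
qed

lemma continuous_on_restrict_args:
  fixes g :: "('i \<Rightarrow> 'a::topological_space) \<Rightarrow> 'b::topological_space"
  assumes "continuous_map (product_topology (\<lambda>_. euclidean) I) euclidean g"
  shows "continuous_on UNIV (\<lambda>u. g (restrict u I))"
proof -
  have "continuous_map euclidean (product_topology (\<lambda>_. euclidean) I) (\<lambda>u :: 'i \<Rightarrow> 'a. restrict u I)"
    by (auto simp: continuous_map_componentwise intro: continuous_on_product_coordinates)
  then have "continuous_map euclidean euclidean (g \<circ> (\<lambda>u. restrict u I))"
    using assms by (rule continuous_map_compose)
  then show ?thesis by (simp add: o_def)
qed

theorem theorem3p2:
  fixes T :: nat and a :: real
    and \<phi> :: "real ^ 'n \<Rightarrow> real ^ 'n"
    and \<Phi> :: "real ^ 'n \<Rightarrow> real"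
    and \<gamma> :: "(real ^ 'n) \<times> (real ^ 'n) \<Rightarrow> ((real ^ 'n) \<times> (real ^ 'n)) set"
    and f :: "nat \<Rightarrow> (nat \<Rightarrow> real ^ 'n) \<Rightarrow> real ^ 'n"
    and C :: "nat \<Rightarrow> nat \<Rightarrow> real" and c :: real
  assumes "T \<ge> 2" and "a > 0"
    and "\<exists>\<psi>. homeomorphism (ball 0 a) UNIV \<phi> \<psi>"
    and "\<phi> 0 = 0"
    and "\<forall>x\<in>ball 0 a. GDERIV \<Phi> x :> \<phi> x"
    and "C1_on (ball 0 a) \<Phi>"
    and "continuous_on (cball 0 a) \<Phi>"
    and "strictly_convex_on (cball 0 a) \<Phi>"
    and "\<Phi> 0 = 0"
    and "maximal_monotone_op \<gamma>"
    and "(0, 0) \<in> \<gamma> (0, 0)"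
    and "\<forall>n\<in>{1..T}. continuous_map (product_topology (\<lambda>_. euclidean) {0..T + 1}) euclidean (f n)"
    and "\<forall>j\<in>{1..T}. (\<Sum>i=1..T. C i j) < 1"
    and "\<forall>n\<in>{1..T}. \<forall>x \<in> {0..T + 1} \<rightarrow>\<^sub>E UNIV.
           inner (f n x) (x n) \<le>
             (C n n - 1) * (norm (x n))\<^sup>2 + (\<Sum>j\<in>{1..T} - {n}. C n j * (norm (x j))\<^sup>2) + c"
  shows "\<exists>u. is_solution T a \<phi> \<gamma> f u"
proof -
  obtain \<psi> where hom: "homeomorphism (ball 0 a) UNIV \<phi> \<psi>" using assms(3) by blast
  then have cont\<phi>: "continuous_on (ball 0 a) \<phi>" by (simp add: homeomorphism_def)
  have mono: "0 \<le> inner (\<phi> x - \<phi> y) (x - y)" if "x \<in> ball 0 a" "y \<in> ball 0 a" for x y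
    using convex_gradient_monotone[OF strictly_convex_on_imp_convex_on[OF assms(8)]] that assms(5)
    by auto
  have pos: "0 \<le> inner (\<phi> x) x" if "x \<in> ball 0 a" for x
    using mono[OF that, of 0] \<open>a > 0\<close> \<open>\<phi> 0 = 0\<close> by simp
  have mono\<gamma>: "monotone_op \<gamma>" using assms(10) by (simp add: maximal_monotone_op_def)
  define \<epsilon> where "\<epsilon> = Min ((\<lambda>j. 1 - (\<Sum>i=1..T. C i j)) ` {1..T})"
  have "\<epsilon> > 0"
    unfolding \<epsilon>_def using assms(13) \<open>T \<ge> 2\<close> by (subst Min_gr_iff) auto
  have col: "(\<Sum>i=1..T. C i j) \<le> 1 - \<epsilon>" if "j \<in> {1..T}" for j
  proof -
    have "\<epsilon> \<le> 1 - (\<Sum>i=1..T. C i j)" unfolding \<epsilon>_def using that by (intro Min_le) auto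
    then show ?thesis by simp
  qed
  define K where "K = real T * c"
  define F where "F n u = f n (restrict u {0..T + 1})" for n u
  have contF: "continuous_on UNIV (F n)" if "n \<in> {1..T}" for n
    unfolding F_def using assms(12) that by (intro continuous_on_restrict_args) auto
  have F: "(\<Sum>n=1..T. inner (F n u) (u n)) \<le> K - \<epsilon> * (\<Sum>n=1..T. (norm (u n))\<^sup>2)" for u
  proof -
    have "(\<Sum>n=1..T. inner (F n u) (u n)) \<le>
        (\<Sum>n=1..T. (C n n - 1) * (norm (u n))\<^sup>2 + (\<Sum>j\<in>{1..T} - {n}. C n j * (norm (u j))\<^sup>2) + c)"
    proof (rule sum_mono)
      fix n assume n: "n \<in> {1..T}"
      let ?x = "restrict u {0..T + 1}"
      have "inner (f n ?x) (?x n) \<le> (C n n - 1) * (norm (?x n))\<^sup>2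
          + (\<Sum>j\<in>{1..T} - {n}. C n j * (norm (?x j))\<^sup>2) + c"
        by (intro bspec[OF bspec[OF assms(14) n]]) auto
      moreover have "(\<Sum>j\<in>{1..T} - {n}. C n j * (norm (?x j))\<^sup>2) = (\<Sum>j\<in>{1..T} - {n}. C n j * (norm (u j))\<^sup>2)"
        by (intro sum.cong) auto
      ultimately show "inner (F n u) (u n) \<le> (C n n - 1) * (norm (u n))\<^sup>2
          + (\<Sum>j\<in>{1..T} - {n}. C n j * (norm (u j))\<^sup>2) + c"
        using n by (simp add: F_def)
    qed
    also have "\<dots> \<le> K - \<epsilon> * (\<Sum>n=1..T. (norm (u n))\<^sup>2)"
      unfolding K_def using col by (intro dissipative_sum) auto
    finally show ?thesis .
  qed
  obtain \<rho> where \<rho>: "0 < \<rho>" "\<rho> < a" and inside: "\<And>v. v \<in> ball 0 a \<Longrightarrow> inner (\<phi> v) v \<le> K \<Longrightarrow> norm v < \<rho>"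
    using monotone_sublevel_inside[OF \<open>a > 0\<close> hom mono] by metis
  \<comment> \<open>Solutions of the problem with \<open>p\<close> have differences of norm less than \<open>\<rho>\<close>, where \<open>p\<close> and \<open>\<phi>\<close>
    agree.\<close>
  define p where "p x = \<phi> (radial_retraction \<rho> x)" for x
  have rad: "radial_retraction \<rho> x \<in> ball 0 a" for x
    using \<rho> by (simp add: norm_radial_retraction)
  have contp: "continuous_on UNIV p"
    unfolding p_def using rad \<rho>
    by (intro continuous_on_compose2[OF cont\<phi>] continuous_on_radial_retraction) auto
  have p_ge: "inner (\<phi> (radial_retraction \<rho> x)) (radial_retraction \<rho> x) \<le> inner (p x) x" for x
  proof -
    have "0 \<le> inner (\<phi> (radial_retraction \<rho> x)) (radial_retraction \<rho> x)" using pos[OF rad] .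
    then have "0 \<le> inner (p x) x"
      using \<rho> by (simp add: p_def radial_retraction_def zero_le_divide_iff zero_le_mult_iff)
    moreover have "\<rho> / max \<rho> (norm x) \<le> 1" using \<rho> by simp
    ultimately have "\<rho> / max \<rho> (norm x) * inner (p x) x \<le> 1 * inner (p x) x"
      by (intro mult_right_mono) auto
    then show ?thesis by (simp add: p_def radial_retraction_def)
  qed
  have p0: "0 \<le> inner (p x) x" for x
    using pos[OF rad[of x]] p_ge[of x] by simp
  define \<mu> where "\<mu> k = 1 / real (Suc k)" for k
  have \<mu>: "\<mu> k > 0" for k by (simp add: \<mu>_def)
  have \<mu>_lim: "\<mu> \<longlonglongrightarrow> 0"
    unfolding \<mu>_def by (rule LIMSEQ_inverse_real_of_nat[unfolded inverse_eq_divide])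
  define z where "z u = (u 0, u (T + 1))" for u :: "nat \<Rightarrow> real ^ 'n"
  define w where "w u = (\<phi> (fwd_diff u 0), - \<phi> (fwd_diff u T))" for u
  \<comment> \<open>\<open>u 0\<close> and \<open>u (T + 1)\<close> are within \<open>a\<close> of \<open>u 1\<close> and \<open>u T\<close>, which the energy bound controls.\<close>
  define M where "M = sqrt (K / \<epsilon>) + a"
  \<comment> \<open>\<open>u\<close> solves the problem with the operator \<open>Y + \<mu> k I\<close> in the boundary condition, \<open>Y\<close> being the
    Yosida approximation of \<open>\<gamma>\<close> with parameter \<open>\<mu> k\<close>; \<open>Y\<close> is eliminated, as the boundary condition
    says that \<open>Y (z u) = w u - \<mu> k z u\<close>.\<close>
  define approx where "approx k u \<longleftrightarrow>
      (\<forall>n\<in>{1..T}. - fwd_diff (\<lambda>m. \<phi> (fwd_diff u m)) (n - 1) = F n u) \<and>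
      w u - \<mu> k *\<^sub>R z u \<in> \<gamma> (z u - \<mu> k *\<^sub>R (w u - \<mu> k *\<^sub>R z u)) \<and>
      (\<forall>n\<le>T. norm (fwd_diff u n) \<le> \<rho>) \<and> (\<forall>n. norm (u n) \<le> M)" for k u
  have "\<exists>u. approx k u" for k
  proof -
    obtain Y where contY: "continuous_on UNIV Y" and Y: "\<And>y. Y y \<in> \<gamma> (y - \<mu> k *\<^sub>R Y y)"
      using yosida_approximation[OF assms(10,11) \<mu>[of k]] by blast
    have Y0: "0 \<le> inner (Y y) y" for y
    proof -
      have "0 \<le> inner (Y y - (0, 0)) (y - \<mu> k *\<^sub>R Y y - (0, 0))"
        by (rule monotone_opD[OF mono\<gamma> Y assms(11)])
      then have "\<mu> k * inner (Y y) (Y y) \<le> inner (Y y) y"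
        by (simp add: inner_diff_right flip: zero_prod_def)
      moreover have "0 \<le> \<mu> k * inner (Y y) (Y y)"
        using \<mu>[of k] by (intro mult_nonneg_nonneg) auto
      ultimately show ?thesis by simp
    qed
    obtain v where
      eq: "\<And>n. n \<in> {1..T} \<Longrightarrow> - fwd_diff (\<lambda>m. p (fwd_diff v m)) (n - 1) = F n v" and
      bc: "(p (fwd_diff v 0), - p (fwd_diff v T)) = Y (v 0, v (T + 1)) + \<mu> k *\<^sub>R (v 0, v (T + 1))" and
      en: "\<And>n. n \<le> T \<Longrightarrow> inner (p (fwd_diff v n)) (fwd_diff v n) \<le> K" and
      bd: "\<And>n. n \<in> {1..T} \<Longrightarrow> \<epsilon> * (norm (v n))\<^sup>2 \<le> K"
      using regularized_problem[OF \<open>\<epsilon> > 0\<close> \<mu>[of k] contp p0 contY Y0 contF F] by blast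
    have small: "norm (fwd_diff v n) < \<rho>" "p (fwd_diff v n) = \<phi> (fwd_diff v n)" if "n \<le> T" for n
    proof -
      have "norm (radial_retraction \<rho> (fwd_diff v n)) < \<rho>"
        using en[OF that] p_ge[of "fwd_diff v n"] by (intro inside[OF rad]) simp
      moreover from this have "radial_retraction \<rho> (fwd_diff v n) = fwd_diff v n"
        by (rule radial_retraction_id[OF \<rho>(1)])
      ultimately show "norm (fwd_diff v n) < \<rho>" "p (fwd_diff v n) = \<phi> (fwd_diff v n)"
        by (simp_all add: p_def)
    qed
    have inner_bd: "norm (v n) \<le> sqrt (K / \<epsilon>)" if "n \<in> {1..T}" for n
      using bd[OF that] \<open>\<epsilon> > 0\<close> by (intro real_le_rsqrt) (simp add: field_simps)
    have vM: "norm (v n) \<le> M" if "n \<le> T + 1" for n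
    proof -
      consider "n = 0" | "n = T + 1" | "n \<in> {1..T}" using \<open>n \<le> T + 1\<close> by force
      then show ?thesis
      proof cases
        case 1
        then have "norm (v n) \<le> norm (v 1) + norm (fwd_diff v 0)"
          using norm_triangle_ineq4[of "v 1" "fwd_diff v 0"] by (simp add: fwd_diff_def)
        then show ?thesis using inner_bd[of 1] small(1)[of 0] \<rho> \<open>T \<ge> 2\<close> by (simp add: M_def)
      next
        case 2
        then have "norm (v n) \<le> norm (v T) + norm (fwd_diff v T)"
          using norm_triangle_ineq[of "v T" "fwd_diff v T"] by (simp add: fwd_diff_def)
        then show ?thesis using inner_bd[of T] small(1)[of T] \<rho> \<open>T \<ge> 2\<close> by (simp add: M_def)
      next
        case 3
        then show ?thesis using inner_bd[of n] \<open>a > 0\<close> by (simp add: M_def)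
      qed
    qed
    \<comment> \<open>The values of \<open>v\<close> beyond \<open>T + 1\<close> are arbitrary; zero keeps the sequence bounded in every
      coordinate.\<close>
    define u where "u n = (if n \<le> T + 1 then v n else 0)" for n
    have du: "fwd_diff u n = fwd_diff v n" if "n \<le> T" for n
      using that by (simp add: u_def fwd_diff_def)
    have Fu: "F n u = F n v" for n
      unfolding F_def by (rule arg_cong[where f = "f n"]) (auto simp: u_def)
    have zu: "z u = (v 0, v (T + 1))" by (simp add: z_def u_def)
    have wu: "w u - \<mu> k *\<^sub>R z u = Y (z u)"
      using bc unfolding w_def zu by (simp add: du small)
    have "- fwd_diff (\<lambda>m. \<phi> (fwd_diff u m)) (n - 1) = F n u" if "n \<in> {1..T}" for n
    proof -
      have "n - 1 \<le> T" using that by auto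
      then show ?thesis using eq[OF that] that by (simp add: fwd_diff_comp du small Fu)
    qed
    moreover have "w u - \<mu> k *\<^sub>R z u \<in> \<gamma> (z u - \<mu> k *\<^sub>R (w u - \<mu> k *\<^sub>R z u))"
      unfolding wu by (rule Y)
    moreover have "norm (fwd_diff u n) \<le> \<rho>" if "n \<le> T" for n
      using small(1)[OF that] du[OF that] by simp
    moreover have "norm (u n) \<le> M" for n
      using vM[of n] vM[of 0] norm_ge_zero[of "v 0"] by (simp add: u_def del: norm_ge_zero)
    ultimately show ?thesis unfolding approx_def by blast
  qed
  then obtain U where U: "\<And>k. approx k (U k)" by metis
  have eq: "- fwd_diff (\<lambda>m. \<phi> (fwd_diff (U k) m)) (n - 1) = F n (U k)" if "n \<in> {1..T}" for k n
    using U[of k] that unfolding approx_def by blast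
  have bc: "w (U k) - \<mu> k *\<^sub>R z (U k) \<in> \<gamma> (z (U k) - \<mu> k *\<^sub>R (w (U k) - \<mu> k *\<^sub>R z (U k)))" for k
    using U[of k] unfolding approx_def by blast
  have dU: "norm (fwd_diff (U k) n) \<le> \<rho>" if "n \<le> T" for k n
    using U[of k] that unfolding approx_def by blast
  have UM: "norm (U k n) \<le> M" for k n
    using U[of k] unfolding approx_def by blast
  have "\<forall>k. U k \<in> {u. \<forall>n. norm (u n) \<le> M}" using UM by simp
  then obtain v \<sigma> where \<sigma>: "strict_mono \<sigma>" and lim: "(U \<circ> \<sigma>) \<longlonglongrightarrow> v"
    using seq_compactE[OF compact_imp_seq_compact[OF compact_norm_bounded_funs], of U M] by blast
  have lim_at: "(\<lambda>k. U (\<sigma> k) n) \<longlonglongrightarrow> v n" for n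
    using lim by (simp add: tendsto_fun_iff)
  have lim_d: "(\<lambda>k. fwd_diff (U (\<sigma> k)) n) \<longlonglongrightarrow> fwd_diff v n" for n
    unfolding fwd_diff_def by (intro tendsto_intros lim_at)
  have dv: "norm (fwd_diff v n) \<le> \<rho>" if "n \<le> T" for n
    by (rule LIMSEQ_le_const2[OF tendsto_norm[OF lim_d]]) (use dU[OF that] in blast)
  have lim_\<phi>: "(\<lambda>k. \<phi> (fwd_diff (U (\<sigma> k)) n)) \<longlonglongrightarrow> \<phi> (fwd_diff v n)" if "n \<le> T" for n
  proof (rule continuous_on_tendsto_compose[OF cont\<phi> lim_d])
    show "fwd_diff v n \<in> ball 0 a" using dv[OF that] \<rho> by simp
    show "\<forall>\<^sub>F k in sequentially. fwd_diff (U (\<sigma> k)) n \<in> ball 0 a"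
      using dU[OF that] \<rho> by (intro always_eventually) (auto intro: le_less_trans)
  qed
  have eqv: "- fwd_diff (\<lambda>m. \<phi> (fwd_diff v m)) (n - 1) = F n v" if n: "n \<in> {1..T}" for n
  proof -
    have "(\<lambda>k. - fwd_diff (\<lambda>m. \<phi> (fwd_diff (U (\<sigma> k)) m)) (n - 1))
        \<longlonglongrightarrow> - fwd_diff (\<lambda>m. \<phi> (fwd_diff v m)) (n - 1)"
      unfolding fwd_diff_comp using n by (intro tendsto_intros lim_\<phi>) auto
    moreover have "(\<lambda>k. F n (U (\<sigma> k))) \<longlonglongrightarrow> F n v"
      using continuous_on_tendsto_compose[OF contF[OF n] lim] by (simp add: o_def)
    ultimately show ?thesis
      unfolding eq[OF n] by (rule LIMSEQ_unique)
  qed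
  have lim_z: "(\<lambda>k. z (U (\<sigma> k))) \<longlonglongrightarrow> z v"
    unfolding z_def by (intro tendsto_intros lim_at)
  have lim_w: "(\<lambda>k. w (U (\<sigma> k))) \<longlonglongrightarrow> w v"
    unfolding w_def by (intro tendsto_intros lim_\<phi>) auto
  have lim_\<mu>: "(\<lambda>k. \<mu> (\<sigma> k)) \<longlonglongrightarrow> 0"
    using LIMSEQ_subseq_LIMSEQ[OF \<mu>_lim \<sigma>] by (simp add: o_def)
  have lim_y: "(\<lambda>k. w (U (\<sigma> k)) - \<mu> (\<sigma> k) *\<^sub>R z (U (\<sigma> k))) \<longlonglongrightarrow> w v - 0 *\<^sub>R z v"
    by (intro tendsto_intros lim_z lim_w lim_\<mu>)
  have lim_x: "(\<lambda>k. z (U (\<sigma> k)) - \<mu> (\<sigma> k) *\<^sub>R (w (U (\<sigma> k)) - \<mu> (\<sigma> k) *\<^sub>R z (U (\<sigma> k))))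
      \<longlonglongrightarrow> z v - 0 *\<^sub>R (w v - 0 *\<^sub>R z v)"
    by (intro tendsto_intros lim_z lim_y lim_\<mu>)
  have "w v - 0 *\<^sub>R z v \<in> \<gamma> (z v - 0 *\<^sub>R (w v - 0 *\<^sub>R z v))"
    using maximal_monotone_closed[OF assms(10) _ lim_x lim_y] bc by blast
  then have bcv: "w v \<in> \<gamma> (z v)" by simp
  define u where "u = restrict v {0..T + 1}"
  have du: "fwd_diff u n = fwd_diff v n" if "n \<le> T" for n
    using that by (simp add: u_def fwd_diff_def)
  have "is_solution T a \<phi> \<gamma> f u"
    unfolding is_solution_def
  proof (intro conjI ballI)
    show "u \<in> {0..T + 1} \<rightarrow>\<^sub>E UNIV" by (simp add: u_def)
    have "norm (fwd_diff u (n - 1)) < a" if "n \<in> {1..T + 1}" for n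
    proof -
      have "n - 1 \<le> T" using that by auto
      then show ?thesis using dv[of "n - 1"] du[of "n - 1"] \<rho> by simp
    qed
    then show "diff_sup_norm T u < a"
      unfolding diff_sup_norm_def by (subst Max_less_iff) auto
    show bcu: "(\<phi> (fwd_diff u 0), - \<phi> (fwd_diff u T)) \<in> \<gamma> (u 0, u (T + 1))"
      using bcv by (simp add: w_def z_def du) (simp add: u_def)
    then show "(u 0, u (T + 1)) \<in> op_dom \<gamma>" by (auto simp: op_dom_def)
    show "- fwd_diff (\<lambda>m. \<phi> (fwd_diff u m)) (n - 1) = f n u" if "n \<in> {1..T}" for n
    proof -
      have "n - 1 \<le> T" using that by auto
      moreover have "F n v = f n u" by (simp add: F_def u_def)
      ultimately show ?thesis using eqv[OF that] that by (simp add: fwd_diff_comp du)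
    qed
  qed
  then show ?thesis by blast
qed

end
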